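(* Let $\kappa\in\mathbb{R}$ and let $X,X'$ be compact spaces with curvature $\leq\kappa$. For any $\xi\in\left(0,\tfrac1{14}\right]$, let $\beta$ be a number satisfying $0<\beta<\frac{1}{1+2\xi}\min\{\Delta(X),\Delta(X')\}$. If $X$ and $X'$ are $(\xi\beta,\beta)$-Gromov–Hausdorff close, then $X$ and $X'$ are homotopy equivalent. In particular, $$d_{GH}(X,X')<\xi\beta\quad\Longrightarrow\quad X\simeq X'.$$
   Context: **Complete length spaces.** For a metric space $(X,d)$ the length of a continuous path $\gamma:[a,b]\to X$ is $L(\gamma)=\sup\sum_i d(\gamma(t_i),\gamma(t_{i+1}))$ over all partitions. $(X,d)$ is a length space if $d(x_1,x_2)$ is the infimum of lengths of paths joining $x_1,x_2$ for all $x_1,x_2$; it is a complete length space (geodesic space) if moreover any two points are joined by a shortest path, i.e. a path of length $d(x_1,x_2)$. **Convexity radius.** A subset $A$ of a length space is convex if any two points of $A$ are joined by a unique shortest path and this path lies in $A$. The convexity radius is $\rho(X)=\inf_{x\in X}\sup\{r\ge 0\mid \mathbb{B}_X(x,s)\text{ is convex for all }0<s<r\}$, where $\mathbb{B}_X(x,s)$ is the open metric ball. **Curvature $\leq\kappa$.** A complete length space $(X,d)$ has curvature $\leq\kappa$ if for any $x_1,x_2,x_3$ in a convex ball of $X$ (and, if $\kappa>0$, with $d(x_1,x_2)+d(x_2,x_3)+d(x_3,x_1)<2\pi/\sqrt{\kappa}$) and any $y$ on a shortest path joining $x_1$ and $x_3$, we have $d(y,x_2)\le d(\overline y,\overline x_2)$,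 where $\overline x_1,\overline x_2,\overline x_3$ are points of the model surface of constant curvature $\kappa$ with $d(\overline x_i,\overline x_j)=d(x_i,x_j)$ and $\overline y$ is the point on the shortest path joining $\overline x_1$ and $\overline x_3$ with $d(\overline x_1,\overline y)=d(x_1,y)$. **$\Delta(X)$.** $\Delta(X)=\min\{\frac{\pi}{4\sqrt{\kappa}},\rho(X)\}$ if $\kappa>0$, and $\Delta(X)=\rho(X)$ if $\kappa\le0$. **Gromov–Hausdorff notions.** A correspondence between $X$ and $Y$ is a subset $\mathscr{C}\subset X\times Y$ projecting onto both factors. $d_{GH}(X,Y)=\frac12\inf_{\mathscr{C}}\sup_{(x_1,y_1),(x_2,y_2)\in\mathscr{C}}|d_X(x_1,x_2)-d_Y(y_1,y_2)|$ over all correspondences. For $\varepsilon,R>0$, $X$ and $Y$ are $(\varepsilon,R)$-Gromov–Hausdorff close if there is a correspondence $\mathscr{C}\subset X\times Y$ such that for any $(x_1,y_1),(x_2,y_2)\in\mathscr{C}$ with $\min\{d_X(x_1,x_2),d_Y(y_1,y_2)\}\le R$ we have $|d_X(x_1,x_2)-d_Y(y_1,y_2)|\le2\varepsilon$. *)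

theory Defs
  imports "HOL-Analysis.Analysis"
begin

subsection \<open>Lengths, shortest paths, length spaces\<close>

definition joins :: "'a metric \<Rightarrow> 'a \<Rightarrow> 'a \<Rightarrow> real \<Rightarrow> real \<Rightarrow> (real \<Rightarrow> 'a) \<Rightarrow> bool" where
  "joins X x y a b \<gamma> \<longleftrightarrow>
     a \<le> b \<and> continuous_map (top_of_set {a..b}) (mtopology_of X) \<gamma> \<and> \<gamma> a = x \<and> \<gamma> b = y"

definition curve_length :: "'a metric \<Rightarrow> real \<Rightarrow> real \<Rightarrow> (real \<Rightarrow> 'a) \<Rightarrow> ennreal" where
  "curve_length X a b \<gamma> =
     Sup {ennreal (\<Sum>i<n. mdist X (\<gamma> (t i)) (\<gamma> (t (Suc i)))) | n t.
            t 0 = a \<and> t n = b \<and> (\<forall>i<n. t i \<le> t (Suc i))}"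

definition shortest_path :: "'a metric \<Rightarrow> 'a \<Rightarrow> 'a \<Rightarrow> real \<Rightarrow> real \<Rightarrow> (real \<Rightarrow> 'a) \<Rightarrow> bool" where
  "shortest_path X x y a b \<gamma> \<longleftrightarrow>
     joins X x y a b \<gamma> \<and> curve_length X a b \<gamma> = ennreal (mdist X x y)"

definition length_space :: "'a metric \<Rightarrow> bool" where
  "length_space X \<longleftrightarrow>
     (\<forall>x\<in>mspace X. \<forall>y\<in>mspace X.
        ennreal (mdist X x y) = Inf {curve_length X a b \<gamma> | a b \<gamma>. joins X x y a b \<gamma>})"

text \<open>``Complete'' refers to the existence of shortest paths, not to convergence of Cauchy
  sequences.\<close>

definition complete_length_space :: "'a metric \<Rightarrow> bool" where
  "complete_length_space X \<longleftrightarrow> length_space X \<and>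
     (\<forall>x\<in>mspace X. \<forall>y\<in>mspace X. \<exists>a b \<gamma>. shortest_path X x y a b \<gamma>)"

subsection \<open>Convexity\<close>

text \<open>Uniqueness of a shortest path is meant up to reparametrization.  Along a shortest path
  \<open>\<gamma>\<close> from \<open>x\<close> the function \<open>t \<mapsto> d(x, \<gamma>(t))\<close> is continuous and monotone and determines
  \<open>\<gamma>(t)\<close>, so two shortest paths from \<open>x\<close> to \<open>y\<close> agree up to reparametrization exactly if they
  have the same trace.\<close>

definition shortest_traces :: "'a metric \<Rightarrow> 'a \<Rightarrow> 'a \<Rightarrow> 'a set set" where
  "shortest_traces X x y = {\<gamma> ` {a..b} | a b \<gamma>. shortest_path X x y a b \<gamma>}"

definition length_convex :: "'a metric \<Rightarrow> 'a set \<Rightarrow> bool" where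
  "length_convex X A \<longleftrightarrow> A \<subseteq> mspace X \<and>
     (\<forall>x\<in>A. \<forall>y\<in>A. \<exists>C. shortest_traces X x y = {C} \<and> C \<subseteq> A)"

definition convexity_radius :: "'a metric \<Rightarrow> ennreal" where
  "convexity_radius X =
     (INF x\<in>mspace X.
        SUP r\<in>{r::real. 0 \<le> r \<and> (\<forall>s. 0 < s \<and> s < r \<longrightarrow> length_convex X (mball_of X x s))}.
          ennreal r)"

subsection \<open>The model surfaces\<close>

text \<open>The surfaces are realised in \<open>\<real>\<^sup>2 \<times> \<real>\<close>: for \<open>\<kappa> > 0\<close> the unit sphere with the angular
  metric scaled by \<open>1/\<surd>\<kappa>\<close>; for \<open>\<kappa> = 0\<close> the Euclidean plane; for \<open>\<kappa> < 0\<close> the upper sheet of the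
  hyperboloid \<open>|u|\<^sup>2 - t\<^sup>2 = -1\<close> with the hyperbolic metric scaled by \<open>1/\<surd>(-\<kappa>)\<close>.\<close>

definition lorentz :: "(real^2) \<times> real \<Rightarrow> (real^2) \<times> real \<Rightarrow> real" where
  "lorentz p q = snd p * snd q - fst p \<bullet> fst q"

definition model_carrier :: "real \<Rightarrow> ((real^2) \<times> real) set" where
  "model_carrier \<kappa> =
     (if \<kappa> > 0 then {p. norm p = 1}
      else if \<kappa> = 0 then {p. snd p = 0}
      else {p. lorentz p p = 1 \<and> snd p > 0})"

definition model_dist :: "real \<Rightarrow> (real^2) \<times> real \<Rightarrow> (real^2) \<times> real \<Rightarrow> real" where
  "model_dist \<kappa> p q =
     (if p \<in> model_carrier \<kappa> \<and> q \<in> model_carrier \<kappa> then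
        (if \<kappa> > 0 then arccos (p \<bullet> q) / sqrt \<kappa>
         else if \<kappa> = 0 then dist p q
         else arcosh (lorentz p q) / sqrt (- \<kappa>))
      else 0)"

definition model_surface :: "real \<Rightarrow> ((real^2) \<times> real) metric" where
  "model_surface \<kappa> = metric (model_carrier \<kappa>, model_dist \<kappa>)"

lemma inner_unit_bounds:
  fixes p q :: "'a::real_inner"
  assumes "norm p = 1" "norm q = 1"
  shows "- 1 \<le> p \<bullet> q" "p \<bullet> q \<le> 1"
  using Cauchy_Schwarz_ineq2[of p q] assms by auto

lemma arccos_inner_triangle:
  fixes p q r :: "'a::real_inner"
  assumes "norm p = 1" "norm q = 1" "norm r = 1"
  shows "arccos (p \<bullet> r) \<le> arccos (p \<bullet> q) + arccos (q \<bullet> r)"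
proof -
  define a b where "a = p \<bullet> q" and "b = q \<bullet> r"
  have ab: "-1 \<le> a" "a \<le> 1" "-1 \<le> b" "b \<le> 1" and c: "-1 \<le> p \<bullet> r" "p \<bullet> r \<le> 1"
    using inner_unit_bounds assms by (auto simp: a_def b_def)
  show ?thesis
  proof (cases "arccos a + arccos b \<le> pi")
    case False
    then show ?thesis
      using arccos_ubound[OF c] by (simp add: a_def b_def)
  next
    case True
    have 1: "p \<bullet> p = 1" "q \<bullet> q = 1" "r \<bullet> r = 1"
      using assms by (simp_all add: dot_square_norm)
    have n1: "norm (p - a *\<^sub>R q) = sqrt (1 - a\<^sup>2)"
      unfolding norm_eq_sqrt_inner
      by (simp add: inner_diff_left inner_diff_right 1 a_def inner_commute power2_eq_square)
    have n2: "norm (r - b *\<^sub>R q) = sqrt (1 - b\<^sup>2)"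
      unfolding norm_eq_sqrt_inner
      by (simp add: inner_diff_left inner_diff_right 1 b_def inner_commute power2_eq_square)
    have "(p - a *\<^sub>R q) \<bullet> (r - b *\<^sub>R q) = p \<bullet> r - a * b"
      by (simp add: inner_diff_left inner_diff_right 1 a_def b_def inner_commute)
    then have "a * b - sqrt (1 - a\<^sup>2) * sqrt (1 - b\<^sup>2) \<le> p \<bullet> r"
      using Cauchy_Schwarz_ineq2[of "p - a *\<^sub>R q" "r - b *\<^sub>R q"] n1 n2 by auto
    then have le: "cos (arccos a + arccos b) \<le> p \<bullet> r"
      using ab by (simp add: cos_add sin_arccos_abs)
    have "0 \<le> arccos a + arccos b"
      using ab by (simp add: arccos_lbound)
    then have "arccos (cos (arccos a + arccos b)) = arccos a + arccos b"
      using True by (simp add: arccos_cos)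
    then show ?thesis
      using arccos_le_arccos[OF _ le] c by (simp add: a_def b_def)
  qed
qed

lemma arccos_inner_eq_0:
  fixes p q :: "'a::real_inner"
  assumes "norm p = 1" "norm q = 1"
  shows "arccos (p \<bullet> q) = 0 \<longleftrightarrow> p = q"
proof
  assume "arccos (p \<bullet> q) = 0"
  then have "p \<bullet> q = 1"
    using cos_arccos[OF inner_unit_bounds[OF assms]] by simp
  moreover have "(p - q) \<bullet> (p - q) = p \<bullet> p - 2 * (p \<bullet> q) + q \<bullet> q"
    by (simp add: inner_diff_left inner_diff_right inner_commute)
  ultimately have "(p - q) \<bullet> (p - q) = 0"
    by (simp only: dot_square_norm assms) simp
  then show "p = q" by simp
qed (use assms in \<open>simp add: dot_square_norm\<close>)

lemma lorentz_commute: "lorentz p q = lorentz q p"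
  by (simp add: lorentz_def inner_commute)

lemma lorentz_orthogonal_spacelike:
  assumes "lorentz q q = 1" "lorentz v q = 0" "v \<noteq> 0"
  shows "lorentz v v < 0"
proof -
  obtain u t where v: "v = (u, t)" by force
  obtain w s where q: "q = (w, s)" by force
  have s2: "s\<^sup>2 = 1 + w \<bullet> w" and ts: "t * s = u \<bullet> w"
    using assms by (auto simp: lorentz_def v q power2_eq_square)
  have pos: "s\<^sup>2 > 0" using s2 by (simp add: add_pos_nonneg)
  have "u \<noteq> 0"
  proof
    assume "u = 0"
    then have "t = 0" using ts pos by auto
    then show False using \<open>u = 0\<close> assms(3) by (simp add: v zero_prod_def)
  qed
  have "t\<^sup>2 * s\<^sup>2 = (u \<bullet> w)\<^sup>2" using ts by (metis power_mult_distrib)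
  also have "\<dots> \<le> (u \<bullet> u) * (w \<bullet> w)" by (rule Cauchy_Schwarz_ineq)
  also have "\<dots> < (u \<bullet> u) * s\<^sup>2" using \<open>u \<noteq> 0\<close> by (simp add: s2)
  finally have "t\<^sup>2 < u \<bullet> u" using pos by (simp add: mult_less_cancel_right)
  then show ?thesis by (simp add: lorentz_def v power2_eq_square)
qed

lemma lorentz_linear:
  "lorentz (p - q) r = lorentz p r - lorentz q r"
  "lorentz r (p - q) = lorentz r p - lorentz r q"
  "lorentz (c *\<^sub>R p) r = c * lorentz p r"
  "lorentz r (c *\<^sub>R p) = c * lorentz r p"
  by (simp_all add: lorentz_def inner_diff_left inner_diff_right algebra_simps)

lemma lorentz_Cauchy_Schwarz:
  assumes q: "lorentz q q = 1" and v: "lorentz v q = 0" and w: "lorentz w q = 0"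
  shows "(lorentz v w)\<^sup>2 \<le> lorentz v v * lorentz w w"
proof (cases "w = 0")
  case True
  then show ?thesis by (simp add: lorentz_def)
next
  case False
  define g h k where "g = lorentz v v" and "h = lorentz v w" and "k = lorentz w w"
  have k: "k < 0"
    using lorentz_orthogonal_spacelike[OF q w False] by (simp add: k_def)
  define z where "z = k *\<^sub>R v - h *\<^sub>R w"
  have "lorentz z q = 0" by (simp add: z_def lorentz_linear v w)
  then have "lorentz z z \<le> 0"
    using lorentz_orthogonal_spacelike[OF q, of z] by (cases "z = 0") (auto simp: lorentz_def)
  moreover have "lorentz z z = k * (g * k - h\<^sup>2)"
    by (simp add: z_def lorentz_linear g_def h_def k_def lorentz_commute[of w v]
        power2_eq_square algebra_simps)
  ultimately have "0 \<le> g * k - h\<^sup>2"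
    using k by (simp add: mult_le_0_iff)
  then show ?thesis by (simp add: g_def h_def k_def)
qed

lemma lorentz_ge_1:
  assumes p: "lorentz p p = 1" "snd p > 0" and q: "lorentz q q = 1" "snd q > 0"
  shows "1 \<le> lorentz p q" "lorentz p q = 1 \<longleftrightarrow> p = q"
proof -
  define a where "a = lorentz p q"
  define z where "z = p - a *\<^sub>R q"
  have zq: "lorentz z q = 0" by (simp add: z_def lorentz_linear q a_def)
  have zz: "lorentz z z = 1 - a\<^sup>2"
    by (simp add: z_def lorentz_linear p q lorentz_commute[of q p] power2_eq_square flip: a_def)
  have "lorentz z z \<le> 0"
    using lorentz_orthogonal_spacelike[OF q(1) zq] by (cases "z = 0") (auto simp: lorentz_def)
  then have a2: "1 \<le> a\<^sup>2" using zz by simp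
  have "norm (fst p) < snd p" "norm (fst q) < snd q"
    using p q by (auto intro!: power2_less_imp_less[of "norm _"]
        simp: lorentz_def power2_norm_eq_inner) (simp_all add: power2_eq_square)
  then have "norm (fst p) * norm (fst q) < snd p * snd q"
    by (intro mult_strict_mono') auto
  then have "0 < a"
    using norm_cauchy_schwarz[of "fst p" "fst q"] by (simp add: a_def lorentz_def)
  with a2 show "1 \<le> lorentz p q"
    unfolding a_def[symmetric] by (simp add: power2_nonneg_ge_1_iff)
  show "lorentz p q = 1 \<longleftrightarrow> p = q"
  proof
    assume "lorentz p q = 1"
    then have "a = 1" by (simp add: a_def)
    then have "z = 0"
      using lorentz_orthogonal_spacelike[OF q(1) zq] zz by fastforce
    then show "p = q" by (simp add: z_def \<open>a = 1\<close>)
  qed (use q in simp)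
qed

lemma arcosh_lorentz_triangle:
  assumes p: "lorentz p p = 1" "snd p > 0" and q: "lorentz q q = 1" "snd q > 0"
    and r: "lorentz r r = 1" "snd r > 0"
  shows "arcosh (lorentz p r) \<le> arcosh (lorentz p q) + arcosh (lorentz q r)"
proof -
  define a b where "a = lorentz p q" and "b = lorentz q r"
  have ab: "1 \<le> a" "1 \<le> b" and c: "1 \<le> lorentz p r"
    using lorentz_ge_1 p q r by (auto simp: a_def b_def)
  define v w where "v = p - a *\<^sub>R q" and "w = r - b *\<^sub>R q"
  have vw: "lorentz v q = 0" "lorentz w q = 0"
    by (simp_all add: v_def w_def lorentz_linear q a_def b_def lorentz_commute[of r q])
  have vv: "lorentz v v = 1 - a\<^sup>2" and ww: "lorentz w w = 1 - b\<^sup>2" and h: "lorentz v w = lorentz p r - a * b"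
    by (simp_all add: v_def w_def lorentz_linear p q r lorentz_commute[of q p]
        lorentz_commute[of r q] power2_eq_square flip: a_def b_def)
  have "(lorentz p r - a * b)\<^sup>2 \<le> (1 - a\<^sup>2) * (1 - b\<^sup>2)"
    using lorentz_Cauchy_Schwarz[OF q(1) vw] unfolding vv ww h .
  also have "\<dots> = (a\<^sup>2 - 1) * (b\<^sup>2 - 1)"
    by (simp add: algebra_simps)
  finally have "(lorentz p r - a * b)\<^sup>2 \<le> (a\<^sup>2 - 1) * (b\<^sup>2 - 1)" .
  then have "lorentz p r - a * b \<le> sqrt (a\<^sup>2 - 1) * sqrt (b\<^sup>2 - 1)"
    by (simp add: real_le_rsqrt flip: real_sqrt_mult)
  then have "lorentz p r \<le> cosh (arcosh a + arcosh b)"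
    using ab by (simp add: cosh_add sinh_arcosh_real)
  then have "cosh (arcosh (lorentz p r)) \<le> cosh (arcosh a + arcosh b)"
    using c by simp
  then show ?thesis
    using ab c by (subst (asm) cosh_real_nonneg_le_iff) (simp_all add: a_def b_def)
qed

lemma Metric_space_model: "Metric_space (model_carrier \<kappa>) (model_dist \<kappa>)"
proof
  fix p q r
  show "0 \<le> model_dist \<kappa> p q"
    by (auto simp: model_dist_def model_carrier_def inner_unit_bounds arccos_lbound lorentz_ge_1)
  show "model_dist \<kappa> p q = model_dist \<kappa> q p"
    by (simp add: model_dist_def inner_commute dist_commute lorentz_commute)
  show "model_dist \<kappa> p q = 0 \<longleftrightarrow> p = q"
    if "p \<in> model_carrier \<kappa>" "q \<in> model_carrier \<kappa>"
    using that
    by (auto simp: model_dist_def model_carrier_def arccos_inner_eq_0 lorentz_ge_1 dot_square_norm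
        split: if_splits)
  show "model_dist \<kappa> p r \<le> model_dist \<kappa> p q + model_dist \<kappa> q r"
    if "p \<in> model_carrier \<kappa>" "q \<in> model_carrier \<kappa>" "r \<in> model_carrier \<kappa>"
    using that
    by (auto simp: model_dist_def model_carrier_def dist_triangle arccos_inner_triangle
        arcosh_lorentz_triangle divide_right_mono simp flip: add_divide_distrib split: if_splits)
qed

lemma model_surface_simps [simp]:
  "mspace (model_surface \<kappa>) = model_carrier \<kappa>"
  "mdist (model_surface \<kappa>) = model_dist \<kappa>"
  by (simp_all add: model_surface_def Metric_space.mspace_metric Metric_space.mdist_metric
      Metric_space_model)

subsection \<open>Upper curvature bounds\<close>

text \<open>Under the perimeter condition the comparison points exist and are unique up to an isometry
  of the model surface, so it is immaterial which ones are taken.\<close>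

definition curvature_le :: "'a metric \<Rightarrow> real \<Rightarrow> bool" where
  "curvature_le X \<kappa> \<longleftrightarrow> complete_length_space X \<and>
     (\<forall>c s x\<^sub>1 x\<^sub>2 x\<^sub>3 y a b \<gamma>.
        c \<in> mspace X \<and> 0 < s \<and> length_convex X (mball_of X c s) \<and>
        x\<^sub>1 \<in> mball_of X c s \<and> x\<^sub>2 \<in> mball_of X c s \<and> x\<^sub>3 \<in> mball_of X c s \<and>
        (\<kappa> > 0 \<longrightarrow> mdist X x\<^sub>1 x\<^sub>2 + mdist X x\<^sub>2 x\<^sub>3 + mdist X x\<^sub>3 x\<^sub>1 < 2 * pi / sqrt \<kappa>) \<and>
        shortest_path X x\<^sub>1 x\<^sub>3 a b \<gamma> \<and> y \<in> \<gamma> ` {a..b} \<longrightarrow>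
        (\<forall>z\<^sub>1\<in>mspace (model_surface \<kappa>). \<forall>z\<^sub>2\<in>mspace (model_surface \<kappa>).
         \<forall>z\<^sub>3\<in>mspace (model_surface \<kappa>). \<forall>w a' b' \<gamma>'.
           mdist (model_surface \<kappa>) z\<^sub>1 z\<^sub>2 = mdist X x\<^sub>1 x\<^sub>2 \<and>
           mdist (model_surface \<kappa>) z\<^sub>2 z\<^sub>3 = mdist X x\<^sub>2 x\<^sub>3 \<and>
           mdist (model_surface \<kappa>) z\<^sub>1 z\<^sub>3 = mdist X x\<^sub>1 x\<^sub>3 \<and>
           shortest_path (model_surface \<kappa>) z\<^sub>1 z\<^sub>3 a' b' \<gamma>' \<and> w \<in> \<gamma>' ` {a'..b'} \<and>
           mdist (model_surface \<kappa>) z\<^sub>1 w = mdist X x\<^sub>1 y \<longrightarrow>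
           mdist X y x\<^sub>2 \<le> mdist (model_surface \<kappa>) w z\<^sub>2))"

definition Delta :: "real \<Rightarrow> 'a metric \<Rightarrow> ennreal" where
  "Delta \<kappa> X =
     (if \<kappa> > 0 then min (ennreal (pi / (4 * sqrt \<kappa>))) (convexity_radius X)
      else convexity_radius X)"

subsection \<open>Gromov--Hausdorff distance and closeness\<close>

definition correspondence :: "'a metric \<Rightarrow> 'b metric \<Rightarrow> ('a \<times> 'b) set \<Rightarrow> bool" where
  "correspondence X Y C \<longleftrightarrow>
     C \<subseteq> mspace X \<times> mspace Y \<and> fst ` C = mspace X \<and> snd ` C = mspace Y"

definition GH_dist :: "'a metric \<Rightarrow> 'b metric \<Rightarrow> ennreal" where
  "GH_dist X Y =
     (INF C\<in>{C. correspondence X Y C}.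
        SUP ((x\<^sub>1, y\<^sub>1), (x\<^sub>2, y\<^sub>2))\<in>C \<times> C. ennreal \<bar>mdist X x\<^sub>1 x\<^sub>2 - mdist Y y\<^sub>1 y\<^sub>2\<bar>) / 2"

definition GH_close :: "real \<Rightarrow> real \<Rightarrow> 'a metric \<Rightarrow> 'b metric \<Rightarrow> bool" where
  "GH_close \<epsilon> R X Y \<longleftrightarrow>
     (\<exists>C. correspondence X Y C \<and>
        (\<forall>(x\<^sub>1, y\<^sub>1)\<in>C. \<forall>(x\<^sub>2, y\<^sub>2)\<in>C.
           min (mdist X x\<^sub>1 x\<^sub>2) (mdist Y y\<^sub>1 y\<^sub>2) \<le> R \<longrightarrow>
           \<bar>mdist X x\<^sub>1 x\<^sub>2 - mdist Y y\<^sub>1 y\<^sub>2\<bar> \<le> 2 * \<epsilon>))"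

end

theory Submission
  imports Defs
begin

text \<open>Since \<open>\<beta>\<close> is less than both convexity radii, two points of a ball of radius at most \<open>\<beta>\<close> are joined
  by a unique geodesic, which stays in the ball and, by compactness, depends continuously on its end
  points.  Send the points of a fine finite net of \<open>X\<close> to partners in \<open>X'\<close> and extend over the rest
  of \<open>X\<close> by averaging along geodesics: the resulting map is continuous, and it sends \<open>x\<close> into every
  convex set that contains all partners of the points near \<open>x\<close>.  By this property, the map and its
  analogue for the converse correspondence compose to self-maps that keep \<open>x\<close> in the ball of radius
  \<open>\<beta>\<close> about \<open>x\<close>, and such a self-map is homotopic to the identity along geodesics.\<close>

section \<open>Topological preliminaries\<close>

lemma mdist_self [simp]: "x \<in> mspace X \<Longrightarrow> mdist X x x = 0"
  by simp

lemma compact_space_finite_net: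
  assumes "compact_space (mtopology_of X)" "0 < \<delta>"
  obtains K where "finite K" "K \<subseteq> mspace X" "mspace X \<subseteq> (\<Union>p\<in>K. mball_of X p \<delta>)"
proof -
  interpret Metric_space "mspace X" "mdist X" by simp
  have "mtotally_bounded (mspace X)"
    using assms(1) by (simp add: mtopology_of_def compact_space_eq_mcomplete_mtotally_bounded)
  then show thesis
    using that assms(2) unfolding mtotally_bounded_def mball_of_def by metis
qed

lemma continuous_map_if_closed_graph:
  assumes Y: "compact_space Y" and f: "f \<in> topspace X \<rightarrow> topspace Y"
    and graph: "closedin (prod_topology X Y) ((\<lambda>x. (x, f x)) ` topspace X)"
  shows "continuous_map X Y f"
  unfolding continuous_map_closedin
proof (intro conjI allI impI f)
  fix C assume C: "closedin Y C"
  let ?graph = "(\<lambda>x. (x, f x)) ` topspace X"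
  have "closedin (prod_topology X Y) (?graph \<inter> topspace X \<times> C)"
    using graph C by (intro closedin_Int) (auto simp: closedin_prod_Times_iff)
  then have "closedin X (fst ` (?graph \<inter> topspace X \<times> C))"
    using closed_map_fst[OF Y, of X] by (auto simp: closed_map_def)
  also have "fst ` (?graph \<inter> topspace X \<times> C) = {x \<in> topspace X. f x \<in> C}"
    by force
  finally show "closedin X {x \<in> topspace X. f x \<in> C}" .
qed

lemma continuous_map_subtopology_Un_closedin:
  assumes "closedin T S" "closedin T S'"
    and "continuous_map (subtopology T S) Y f" "continuous_map (subtopology T S') Y f"
  shows "continuous_map (subtopology T (S \<union> S')) Y f"
proof (rule pasting_lemma_closed[where I="{S, S'}" and T="\<lambda>U. U" and f="\<lambda>_. f"])
  show "closedin (subtopology T (S \<union> S')) U" if "U \<in> {S, S'}" for U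
    using that assms(1,2) by (auto intro: closedin_subset_topspace)
  show "continuous_map (subtopology (subtopology T (S \<union> S')) U) Y f" if "U \<in> {S, S'}" for U
    using that assms(3,4) by (auto simp: subtopology_subtopology Int_absorb1)
qed auto

section \<open>Shortest paths\<close>

definition metric_between :: "'a metric \<Rightarrow> 'a \<Rightarrow> 'a \<Rightarrow> 'a \<Rightarrow> bool" where
  "metric_between X x y z \<longleftrightarrow> x \<in> mspace X \<and> y \<in> mspace X \<and> z \<in> mspace X \<and>
     mdist X x y + mdist X y z = mdist X x z"

lemma metric_betweenD:
  assumes "metric_between X x y z"
  shows "x \<in> mspace X" "y \<in> mspace X" "z \<in> mspace X" "mdist X x y + mdist X y z = mdist X x z"
  using assms by (auto simp: metric_between_def)

lemma metric_between_commute: "metric_between X x y z \<longleftrightarrow> metric_between X z y x"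
  by (auto simp: metric_between_def mdist_commute)

lemma metric_between_trans:
  assumes xyz: "metric_between X x y z" and xwy: "metric_between X x w y"
  shows "metric_between X x w z"
  using metric_betweenD[OF xyz] metric_betweenD[OF xwy]
    mdist_triangle[of w X y z] mdist_triangle[of x X w z]
  unfolding metric_between_def by simp

lemma metric_between_trans_right:
  assumes "metric_between X x y z" "metric_between X y w z"
  shows "metric_between X x w z"
  using metric_between_trans[of X z y x w] assms by (simp add: metric_between_commute[of X z])

lemma metric_between_inner:
  assumes xyz: "metric_between X x y z" and ywz: "metric_between X y w z"
  shows "metric_between X x y w"
  using metric_betweenD[OF xyz] metric_betweenD[OF ywz]
    mdist_triangle[of x X w z] mdist_triangle[of x X y w]
  unfolding metric_between_def by simp

lemma joins_in_mspace:
  assumes "joins X x z a b \<gamma>" "s \<in> {a..b}"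
  shows "\<gamma> s \<in> mspace X"
  using assms unfolding joins_def continuous_map_def by (auto simp: Pi_iff)

lemma joins_endpoints_in_mspace:
  assumes "joins X x z a b \<gamma>"
  shows "x \<in> mspace X" "z \<in> mspace X"
  using joins_in_mspace[OF assms, of a] joins_in_mspace[OF assms, of b] assms
  by (auto simp: joins_def)

lemma joins_concat:
  assumes \<gamma>: "joins X x y a b \<gamma>" and \<gamma>': "joins X y z a' b' \<gamma>'"
  shows "joins X x z a (b + (b' - a')) (\<lambda>u. if u \<le> b then \<gamma> u else \<gamma>' (u - b + a'))"
proof -
  let ?T = "top_of_set {a..b + (b' - a')}"
  let ?second = "top_of_set {b..b + (b' - a')}"
  have ab: "a \<le> b" "a' \<le> b'"
    and ends: "\<gamma> a = x" "\<gamma> b = y" "\<gamma>' a' = y" "\<gamma>' b' = z"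
    and cont: "continuous_map (top_of_set {a..b}) (mtopology_of X) \<gamma>"
    and cont': "continuous_map (top_of_set {a'..b'}) (mtopology_of X) \<gamma>'"
    using \<gamma> \<gamma>' by (auto simp: joins_def)
  have "continuous_map ?second (top_of_set {a'..b'}) (\<lambda>u. u - b + a')"
    by (auto simp: continuous_map_in_subtopology simp del: continuous_map_iff_continuous
        intro!: continuous_intros)
  then have shifted: "continuous_map ?second (mtopology_of X) (\<lambda>u. \<gamma>' (u - b + a'))"
    using continuous_map_compose[OF _ cont', unfolded o_def] by blast
  have "continuous_map ?T (mtopology_of X) (\<lambda>u. if u \<le> b then \<gamma> u else \<gamma>' (u - b + a'))"
  proof (rule continuous_map_cases_le)
    have "{u. u \<in> topspace ?T \<and> u \<le> b} = {a..b}" "{u. u \<in> topspace ?T \<and> b \<le> u} = {b..b + (b' - a')}"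
      using ab by auto
    then show
      "continuous_map (subtopology ?T {u. u \<in> topspace ?T \<and> u \<le> b}) (mtopology_of X) \<gamma>"
      "continuous_map (subtopology ?T {u. u \<in> topspace ?T \<and> b \<le> u}) (mtopology_of X)
         (\<lambda>u. \<gamma>' (u - b + a'))"
      using cont shifted ab by (simp_all add: subtopology_subtopology Int_absorb1)
  qed (use ends in auto)
  moreover have "\<gamma> (b + (b' - a')) = z" if "b' \<le> a'"
    using that ab ends by auto
  ultimately show ?thesis
    using ab ends by (auto simp: joins_def)
qed

lemma shortest_path_joins: "shortest_path X x z a b \<gamma> \<Longrightarrow> joins X x z a b \<gamma>"
  by (simp add: shortest_path_def)

lemma shortest_path_three_segments:
  assumes \<gamma>: "shortest_path X x z a b \<gamma>" and "a \<le> s" "s \<le> t" "t \<le> b"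
  shows "mdist X x (\<gamma> s) + mdist X (\<gamma> s) (\<gamma> t) + mdist X (\<gamma> t) z \<le> mdist X x z"
proof -
  define p where "p = (\<lambda>i. [a, s, t, b] ! i)"
  have "ennreal (\<Sum>i<3. mdist X (\<gamma> (p i)) (\<gamma> (p (Suc i)))) \<le> curve_length X a b \<gamma>"
    unfolding curve_length_def
    by (rule Sup_upper)
       (use assms in \<open>auto simp: p_def less_Suc_eq numeral_3_eq_3
          intro!: exI[of _ "3::nat"] exI[of _ p]\<close>)
  also have "\<dots> = ennreal (mdist X x z)"
    using \<gamma> by (simp add: shortest_path_def)
  finally have "(\<Sum>i<3. mdist X (\<gamma> (p i)) (\<gamma> (p (Suc i)))) \<le> mdist X x z"
    by simp
  then show ?thesis
    using \<gamma> by (simp add: p_def numeral_3_eq_3 shortest_path_def joins_def)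
qed

lemma shortest_path_between:
  assumes \<gamma>: "shortest_path X x z a b \<gamma>" and st: "a \<le> s" "s \<le> t" "t \<le> b"
  shows "metric_between X x (\<gamma> s) (\<gamma> t)"
proof -
  have "x \<in> mspace X" "z \<in> mspace X" "\<gamma> s \<in> mspace X" "\<gamma> t \<in> mspace X"
    using joins_endpoints_in_mspace[OF shortest_path_joins[OF \<gamma>]]
      joins_in_mspace[OF shortest_path_joins[OF \<gamma>]] st
    by auto
  then show ?thesis
    using shortest_path_three_segments[OF \<gamma> st] mdist_triangle[of x X "\<gamma> t" z]
      mdist_triangle[of x X "\<gamma> s" "\<gamma> t"]
    by (simp add: metric_between_def)
qed

lemma shortest_path_between_endpoints:
  assumes "shortest_path X x z a b \<gamma>" "s \<in> {a..b}"
  shows "metric_between X x (\<gamma> s) z"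
  using shortest_path_between[OF assms(1), of s b] assms
  by (simp add: shortest_path_def joins_def)

lemma curve_length_eqI:
  assumes "a \<le> b"
    and sum: "\<And>n t. \<lbrakk>t 0 = a; t n = b; \<And>i. i < n \<Longrightarrow> t i \<le> t (Suc i)\<rbrakk> \<Longrightarrow>
      (\<Sum>i<n. mdist X (\<gamma> (t i)) (\<gamma> (t (Suc i)))) = l"
  shows "curve_length X a b \<gamma> = ennreal l"
proof -
  let ?sums = "{ennreal (\<Sum>i<n. mdist X (\<gamma> (t i)) (\<gamma> (t (Suc i)))) | n t.
    t 0 = a \<and> t n = b \<and> (\<forall>i<n. t i \<le> t (Suc i))}"
  have "ennreal l \<in> ?sums"
    using sum[of "\<lambda>i. if i = 0 then a else b" 1] \<open>a \<le> b\<close>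
    by (auto intro!: exI[of _ 1] exI[of _ "\<lambda>i. if i = 0 then a else b"])
  moreover have "?sums \<subseteq> {ennreal l}"
    using sum by auto
  ultimately have "?sums = {ennreal l}"
    by blast
  then show ?thesis
    by (simp add: curve_length_def)
qed

lemma shortest_path_if_between:
  assumes joins: "joins X x z a b \<gamma>"
    and between: "\<And>s t. \<lbrakk>a \<le> s; s \<le> t; t \<le> b\<rbrakk> \<Longrightarrow> metric_between X x (\<gamma> s) (\<gamma> t)"
  shows "shortest_path X x z a b \<gamma>"
proof -
  have ends: "a \<le> b" "\<gamma> a = x" "\<gamma> b = z" and x: "x \<in> mspace X"
    using joins joins_endpoints_in_mspace[OF joins] by (auto simp: joins_def)
  have "(\<Sum>i<n. mdist X (\<gamma> (t i)) (\<gamma> (t (Suc i)))) = mdist X x z"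
    if t: "t 0 = a" "t n = b" "\<And>i. i < n \<Longrightarrow> t i \<le> t (Suc i)" for n and t :: "nat \<Rightarrow> real"
  proof -
    have mono: "t i \<le> t j" if "i \<le> j" "j \<le> n" for i j
      using that by (induction j rule: dec_induct) (use t(3) in \<open>auto intro: order_trans\<close>)
    have "mdist X (\<gamma> (t i)) (\<gamma> (t (Suc i))) = mdist X x (\<gamma> (t (Suc i))) - mdist X x (\<gamma> (t i))"
      if "i < n" for i
      using metric_betweenD(4)[OF between[of "t i" "t (Suc i)"]] mono[of 0 i] mono[of "Suc i" n] t that
      by simp
    then have "(\<Sum>i<n. mdist X (\<gamma> (t i)) (\<gamma> (t (Suc i)))) =
        (\<Sum>i<n. mdist X x (\<gamma> (t (Suc i))) - mdist X x (\<gamma> (t i)))"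
      by simp
    also have "\<dots> = mdist X x z"
      using t ends x by (simp add: sum_lessThan_telescope[where f="\<lambda>i. mdist X x (\<gamma> (t i))"])
    finally show ?thesis .
  qed
  then have "curve_length X a b \<gamma> = ennreal (mdist X x z)"
    by (rule curve_length_eqI[OF ends(1)])
  then show ?thesis
    using joins by (simp add: shortest_path_def)
qed

lemma shortest_path_concat:
  assumes \<gamma>: "shortest_path X x y a b \<gamma>" and \<gamma>': "shortest_path X y z a' b' \<gamma>'"
    and xyz: "metric_between X x y z"
  shows "shortest_path X x z a (b + (b' - a')) (\<lambda>u. if u \<le> b then \<gamma> u else \<gamma>' (u - b + a'))"
proof (rule shortest_path_if_between)
  show "joins X x z a (b + (b' - a')) (\<lambda>u. if u \<le> b then \<gamma> u else \<gamma>' (u - b + a'))"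
    using \<gamma> \<gamma>' by (intro joins_concat shortest_path_joins)
  have via_y: "metric_between X x y (\<gamma>' t)" if "t \<in> {a'..b'}" for t
    using xyz shortest_path_between_endpoints[OF \<gamma>' that] by (rule metric_between_inner)
  fix s t assume st: "a \<le> s" "s \<le> t" "t \<le> b + (b' - a')"
  then consider (first) "t \<le> b" | (across) "s \<le> b" "b < t" | (second) "b < s"
    by linarith
  then show "metric_between X x (if s \<le> b then \<gamma> s else \<gamma>' (s - b + a'))
      (if t \<le> b then \<gamma> t else \<gamma>' (t - b + a'))"
  proof cases
    case first
    then show ?thesis
      using shortest_path_between[OF \<gamma> st(1,2)] st by simp
  next
    case across
    then show ?thesis
      using metric_between_trans[OF via_y[of "t - b + a'"]
          shortest_path_between_endpoints[OF \<gamma>, of s]] st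
      by simp
  next
    case second
    then show ?thesis
      using metric_between_trans_right[OF via_y[of "t - b + a'"]
          shortest_path_between[OF \<gamma>', of "s - b + a'" "t - b + a'"]] st
      by simp
  qed
qed

lemma complete_length_space_shortest_path:
  assumes "complete_length_space X" "x \<in> mspace X" "z \<in> mspace X"
  obtains a b \<gamma> where "shortest_path X x z a b \<gamma>"
  using assms unfolding complete_length_space_def by blast

lemma complete_length_space_shortest_path_through:
  assumes X: "complete_length_space X" and xyz: "metric_between X x y z"
  obtains a b \<gamma> where "shortest_path X x z a b \<gamma>" "y \<in> \<gamma> ` {a..b}"
proof -
  note in_mspace = metric_betweenD(1-3)[OF xyz]
  obtain a b \<gamma> where \<gamma>: "shortest_path X x y a b \<gamma>"
    using complete_length_space_shortest_path[OF X in_mspace(1,2)] .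
  obtain a' b' \<gamma>' where \<gamma>': "shortest_path X y z a' b' \<gamma>'"
    using complete_length_space_shortest_path[OF X in_mspace(2,3)] .
  have "a \<le> b" "\<gamma> b = y" "a' \<le> b'"
    using \<gamma> \<gamma>' by (auto simp: shortest_path_def joins_def)
  then have "y \<in> (\<lambda>u. if u \<le> b then \<gamma> u else \<gamma>' (u - b + a')) ` {a..b + (b' - a')}"
    by (intro image_eqI[of _ _ b]) auto
  then show thesis
    using that shortest_path_concat[OF \<gamma> \<gamma>' xyz] by blast
qed

lemma shortest_path_attains_distance:
  assumes \<gamma>: "shortest_path X x z a b \<gamma>" and u: "0 \<le> u" "u \<le> mdist X x z"
  obtains s where "s \<in> {a..b}" "mdist X x (\<gamma> s) = u"
proof -
  have \<gamma>_props: "a \<le> b" "\<gamma> a = x" "\<gamma> b = z" "x \<in> mspace X"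
    "continuous_map (top_of_set {a..b}) (mtopology_of X) \<gamma>"
    using shortest_path_joins[OF \<gamma>] joins_endpoints_in_mspace[OF shortest_path_joins[OF \<gamma>]]
    by (auto simp: joins_def)
  then have "continuous_on {a..b} (\<lambda>s. mdist X x (\<gamma> s))"
    by (simp flip: continuous_map_iff_continuous) (intro continuous_intros, auto)
  moreover have "mdist X x (\<gamma> a) \<le> u" "u \<le> mdist X x (\<gamma> b)"
    using \<gamma>_props u by simp_all
  ultimately show thesis
    using IVT'[of "\<lambda>s. mdist X x (\<gamma> s)" a u b] \<gamma>_props(1) that by auto
qed

section \<open>Convex sets\<close>

lemma
  assumes A: "length_convex X A" "x \<in> A" "z \<in> A" and \<gamma>: "shortest_path X x z a b \<gamma>"
  shows length_convex_shortest_path_subset: "\<gamma> ` {a..b} \<subseteq> A"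
    and length_convex_shortest_path_unique:
      "shortest_path X x z a' b' \<gamma>' \<Longrightarrow> \<gamma>' ` {a'..b'} = \<gamma> ` {a..b}"
proof -
  obtain C where C: "shortest_traces X x z = {C}" "C \<subseteq> A"
    using A unfolding length_convex_def by blast
  have trace: "\<sigma> ` {c..d} = C" if "shortest_path X x z c d \<sigma>" for c d \<sigma>
  proof -
    have "\<sigma> ` {c..d} \<in> shortest_traces X x z"
      using that by (auto simp: shortest_traces_def)
    then show ?thesis
      using C(1) by simp
  qed
  show "\<gamma> ` {a..b} \<subseteq> A"
    using trace[OF \<gamma>] C(2) by simp
  show "shortest_path X x z a' b' \<gamma>' \<Longrightarrow> \<gamma>' ` {a'..b'} = \<gamma> ` {a..b}"
    using trace \<gamma> by simp
qed

lemma length_convex_between: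
  assumes X: "complete_length_space X" and A: "length_convex X A" "x \<in> A" "z \<in> A"
    and xyz: "metric_between X x y z"
  shows "y \<in> A"
proof -
  obtain a b \<gamma> where "shortest_path X x z a b \<gamma>" "y \<in> \<gamma> ` {a..b}"
    using complete_length_space_shortest_path_through[OF X xyz] .
  then show ?thesis
    using length_convex_shortest_path_subset[OF A] by blast
qed

lemma length_convex_between_unique:
  assumes X: "complete_length_space X" and A: "length_convex X A" "x \<in> A" "z \<in> A"
    and between: "metric_between X x y z" "metric_between X x y' z"
    and dist: "mdist X x y = mdist X x y'"
  shows "y = y'"
proof -
  obtain a b \<gamma> where \<gamma>: "shortest_path X x z a b \<gamma>" "y \<in> \<gamma> ` {a..b}"
    using complete_length_space_shortest_path_through[OF X between(1)] .
  obtain a' b' \<gamma>' where \<gamma>': "shortest_path X x z a' b' \<gamma>'" "y' \<in> \<gamma>' ` {a'..b'}"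
    using complete_length_space_shortest_path_through[OF X between(2)] .
  obtain s t where "s \<in> {a..b}" "y = \<gamma> s" "t \<in> {a..b}" "y' = \<gamma> t"
    using \<gamma>(2) \<gamma>'(2) length_convex_shortest_path_unique[OF A \<gamma>(1) \<gamma>'(1)] by auto
  then have "metric_between X x y y' \<or> metric_between X x y' y"
    using shortest_path_between[OF \<gamma>(1)] by (cases "s \<le> t") auto
  then have "mdist X y y' = 0"
    using dist by (auto simp: metric_between_def mdist_commute)
  then show ?thesis
    using between by (simp add: metric_between_def)
qed

lemma length_convex_mball:
  assumes "c \<in> mspace X" "0 < s" "ennreal s < convexity_radius X"
  shows "length_convex X (mball_of X c s)"
proof -
  have "ennreal s <
    (SUP r\<in>{r::real. 0 \<le> r \<and> (\<forall>s. 0 < s \<and> s < r \<longrightarrow> length_convex X (mball_of X c s))}. ennreal r)"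
    using assms(1,3) unfolding convexity_radius_def by (meson INF_lower less_le_trans)
  then obtain r where r: "\<forall>s. 0 < s \<and> s < r \<longrightarrow> length_convex X (mball_of X c s)"
    and "ennreal s < ennreal r"
    unfolding less_SUP_iff by blast
  then have "s < r"
    using assms(2) by (simp add: ennreal_less_iff)
  then show ?thesis
    using r assms(2) by blast
qed

section \<open>Dividing segments in a given ratio\<close>

definition division_point :: "'a metric \<Rightarrow> 'a \<Rightarrow> 'a \<Rightarrow> real \<Rightarrow> 'a \<Rightarrow> bool" where
  "division_point X x z t y \<longleftrightarrow> y \<in> mspace X \<and>
     mdist X x y = t * mdist X x z \<and> mdist X y z = (1 - t) * mdist X x z"

definition divide_segment :: "'a metric \<Rightarrow> 'a \<Rightarrow> 'a \<Rightarrow> real \<Rightarrow> 'a" where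
  "divide_segment X x z t = (SOME y. division_point X x z t y)"

lemma division_point_between:
  assumes "x \<in> mspace X" "z \<in> mspace X" "division_point X x z t y"
  shows "metric_between X x y z"
  using assms by (simp add: division_point_def metric_between_def algebra_simps)

lemma division_point_0:
  "x \<in> mspace X \<Longrightarrow> division_point X x z 0 y \<longleftrightarrow> y = x"
  by (auto simp: division_point_def)

lemma division_point_1:
  "z \<in> mspace X \<Longrightarrow> division_point X x z 1 y \<longleftrightarrow> y = z"
  by (auto simp: division_point_def)

lemma divide_segment_0 [simp]: "x \<in> mspace X \<Longrightarrow> divide_segment X x z 0 = x"
  by (simp add: divide_segment_def division_point_0)

lemma divide_segment_1 [simp]: "z \<in> mspace X \<Longrightarrow> divide_segment X x z 1 = z"
  by (simp add: divide_segment_def division_point_1)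

lemma division_point_divide_segment:
  assumes X: "complete_length_space X" and in_mspace: "x \<in> mspace X" "z \<in> mspace X"
    and t: "t \<in> {0..1}"
  shows "division_point X x z t (divide_segment X x z t)"
proof -
  obtain a b \<gamma> where \<gamma>: "shortest_path X x z a b \<gamma>"
    using complete_length_space_shortest_path[OF X in_mspace] .
  have "0 \<le> t * mdist X x z" "t * mdist X x z \<le> mdist X x z"
    using t by (auto simp: mult_left_le_one_le)
  then obtain s where s: "s \<in> {a..b}" "mdist X x (\<gamma> s) = t * mdist X x z"
    using shortest_path_attains_distance[OF \<gamma>] by blast
  then have "division_point X x z t (\<gamma> s)"
    using shortest_path_between_endpoints[OF \<gamma> s(1)]
    by (simp add: division_point_def metric_between_def algebra_simps)
  then show ?thesis
    unfolding divide_segment_def by (rule someI)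
qed

lemma divide_segment_in_length_convex:
  assumes X: "complete_length_space X" and A: "length_convex X A" "x \<in> A" "z \<in> A"
    and t: "t \<in> {0..1}"
  shows "divide_segment X x z t \<in> A"
proof -
  have in_mspace: "x \<in> mspace X" "z \<in> mspace X"
    using A by (auto simp: length_convex_def)
  have "metric_between X x (divide_segment X x z t) z"
    using division_point_between[OF in_mspace division_point_divide_segment[OF X in_mspace t]] .
  then show ?thesis
    by (rule length_convex_between[OF X A])
qed

lemma division_point_unique:
  assumes X: "complete_length_space X" and A: "length_convex X A" "x \<in> A" "z \<in> A"
    and y: "division_point X x z t y" and y': "division_point X x z t y'"
  shows "y = y'"
proof (rule length_convex_between_unique[OF X A])
  have "x \<in> mspace X" "z \<in> mspace X"
    using A by (auto simp: length_convex_def)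
  then show "metric_between X x y z" "metric_between X x y' z"
    using y y' by (auto intro: division_point_between)
qed (use y y' in \<open>simp add: division_point_def\<close>)

lemma closedin_division_points:
  assumes "continuous_map T (mtopology_of X) a" "continuous_map T (mtopology_of X) b"
    and "continuous_map T euclideanreal \<tau>"
  shows "closedin (prod_topology T (mtopology_of X))
    {p \<in> topspace T \<times> mspace X. division_point X (a (fst p)) (b (fst p)) (\<tau> (fst p)) (snd p)}"
    (is "closedin ?P ?S")
proof -
  note [continuous_intros] = continuous_map_snd
    assms[THEN continuous_map_compose[OF continuous_map_fst], unfolded o_def]
  have "?S =
      {p \<in> topspace ?P. mdist X (a (fst p)) (snd p) = \<tau> (fst p) * mdist X (a (fst p)) (b (fst p))} \<inter>
      {p \<in> topspace ?P. mdist X (snd p) (b (fst p)) = (1 - \<tau> (fst p)) * mdist X (a (fst p)) (b (fst p))}"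
    by (auto simp: division_point_def)
  also have "closedin ?P \<dots>"
    by (intro closedin_Int closedin_continuous_maps_eq[where Y=euclideanreal] continuous_intros) auto
  finally show ?thesis .
qed

text \<open>By uniqueness, the graph is the closed set of all division points.  Where \<open>\<tau>\<close> vanishes, the
  division point is \<open>a w\<close> wherever \<open>b w\<close> lies.\<close>

lemma continuous_map_divide_segment:
  assumes X: "compact_space (mtopology_of X)" "complete_length_space X"
    and a: "continuous_map T (mtopology_of X) a" and b: "continuous_map T (mtopology_of X) b"
    and \<tau>: "continuous_map T euclideanreal \<tau>"
    and \<tau>_bounds: "\<And>w. w \<in> topspace T \<Longrightarrow> \<tau> w \<in> {0..1}"
    and A: "\<And>w. w \<in> topspace T \<Longrightarrow> length_convex X (A w)"
    and a_in: "\<And>w. w \<in> topspace T \<Longrightarrow> a w \<in> A w"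
    and b_in: "\<And>w. w \<in> topspace T \<Longrightarrow> \<tau> w \<noteq> 0 \<Longrightarrow> b w \<in> A w"
  shows "continuous_map T (mtopology_of X) (\<lambda>w. divide_segment X (a w) (b w) (\<tau> w))"
proof (rule continuous_map_if_closed_graph[OF X(1)])
  let ?h = "\<lambda>w. divide_segment X (a w) (b w) (\<tau> w)"
  have div: "division_point X (a w) (b w) (\<tau> w) (?h w)" if "w \<in> topspace T" for w
    using a b \<tau>_bounds that
    by (intro division_point_divide_segment[OF X(2)]) (auto simp: continuous_map_def)
  then have h_in_mspace: "?h w \<in> mspace X" if "w \<in> topspace T" for w
    using that by (simp add: division_point_def)
  then show "?h \<in> topspace T \<rightarrow> topspace (mtopology_of X)"
    by simp
  have "y = ?h w" if w: "w \<in> topspace T" and y: "division_point X (a w) (b w) (\<tau> w) y" for w y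
  proof (cases "\<tau> w = 0")
    case True
    have "a w \<in> mspace X"
      using A[OF w] a_in[OF w] by (auto simp: length_convex_def)
    then show ?thesis
      using True y by (simp add: division_point_0)
  next
    case False
    then show ?thesis
      using division_point_unique[OF X(2) A a_in b_in y div] w by blast
  qed
  then have "(\<lambda>w. (w, ?h w)) ` topspace T =
    {p \<in> topspace T \<times> mspace X. division_point X (a (fst p)) (b (fst p)) (\<tau> (fst p)) (snd p)}"
    using div h_in_mspace by force
  then show "closedin (prod_topology T (mtopology_of X)) ((\<lambda>w. (w, ?h w)) ` topspace T)"
    using closedin_division_points[OF a b \<tau>] by simp
qed

lemma homotopic_with_if_common_length_convex:
  assumes X: "compact_space (mtopology_of X)" "complete_length_space X"
    and f: "continuous_map T (mtopology_of X) f" and g: "continuous_map T (mtopology_of X) g"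
    and A: "\<And>w. w \<in> topspace T \<Longrightarrow> length_convex X (A w)"
    and f_in: "\<And>w. w \<in> topspace T \<Longrightarrow> f w \<in> A w" and g_in: "\<And>w. w \<in> topspace T \<Longrightarrow> g w \<in> A w"
  shows "homotopic_with (\<lambda>_. True) T (mtopology_of X) f g"
proof -
  let ?P = "prod_topology (top_of_set {0..1::real}) T"
  let ?h = "\<lambda>p. divide_segment X (f (snd p)) (g (snd p)) (fst p)"
  have "continuous_map ?P euclideanreal fst"
    using continuous_map_fst[of "top_of_set {0..1::real}" T]
    by (simp add: continuous_map_in_subtopology)
  then have "continuous_map ?P (mtopology_of X) ?h"
    using f g A f_in g_in
    by (intro continuous_map_divide_segment[OF X, where A="\<lambda>p. A (snd p)"])
       (auto intro: continuous_map_compose[OF continuous_map_snd, unfolded o_def])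
  moreover have "f w \<in> mspace X" "g w \<in> mspace X" if "w \<in> topspace T" for w
    using f g that by (auto simp: continuous_map_def)
  ultimately show ?thesis
    by (subst homotopic_with) (auto intro!: exI[of _ ?h])
qed

section \<open>Averaging along geodesics\<close>

text \<open>Starting from \<open>e i\<close> for the first index \<open>i\<close> of weight 1, move along geodesics towards the values
  at the preceding indices, last to first.  If there is no such \<open>i\<close>, the result has no meaning.\<close>

primrec geodesic_average :: "'a metric \<Rightarrow> ('i \<Rightarrow> 'a) \<Rightarrow> ('i \<Rightarrow> real) \<Rightarrow> 'i list \<Rightarrow> 'a" where
  "geodesic_average X e t [] = undefined"
| "geodesic_average X e t (k # ks) = divide_segment X (geodesic_average X e t ks) (e k) (t k)"

lemma geodesic_average_in_length_convex:
  assumes X: "complete_length_space X" and A: "length_convex X A"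
    and "\<And>i. i \<in> set ks \<Longrightarrow> t i \<in> {0..1}" "\<And>i. i \<in> set ks \<Longrightarrow> t i \<noteq> 0 \<Longrightarrow> e i \<in> A"
    and "\<exists>i\<in>set ks. t i = 1"
  shows "geodesic_average X e t ks \<in> A"
  using assms(3-)
proof (induction ks)
  case (Cons k ks)
  show ?case
  proof (cases "t k = 1")
    case True
    then show ?thesis
      using Cons.prems(2)[of k] A by (auto simp: length_convex_def)
  next
    case False
    then have IH: "geodesic_average X e t ks \<in> A"
      using Cons by auto
    then have "geodesic_average X e t ks \<in> mspace X"
      using A by (auto simp: length_convex_def)
    then show ?thesis
      using IH Cons.prems(1,2) divide_segment_in_length_convex[OF X A IH] by (cases "t k = 0") auto
  qed
qed simp

text \<open>Where \<open>\<psi> k = 1\<close>, the value at \<open>k\<close> overrides the average over \<open>ks\<close>, which need not be continuous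
  there.\<close>

lemma continuous_map_geodesic_average:
  assumes X: "compact_space (mtopology_of X)" "complete_length_space X"
    and A: "\<And>w. w \<in> topspace T \<Longrightarrow> length_convex X (A w)"
    and "\<And>i. i \<in> set ks \<Longrightarrow> continuous_map T euclideanreal (\<psi> i)"
    and "\<And>i w. i \<in> set ks \<Longrightarrow> w \<in> topspace T \<Longrightarrow> \<psi> i w \<in> {0..1}"
    and "\<And>i. i \<in> set ks \<Longrightarrow> e i \<in> mspace X"
    and "\<And>i w. \<lbrakk>i \<in> set ks; w \<in> topspace T; \<psi> i w \<noteq> 0\<rbrakk> \<Longrightarrow> e i \<in> A w"
  shows "continuous_map (subtopology T {w \<in> topspace T. \<exists>i\<in>set ks. \<psi> i w = 1}) (mtopology_of X)
    (\<lambda>w. geodesic_average X e (\<lambda>i. \<psi> i w) ks)"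
  using assms(4-)
proof (induction ks)
  case Nil
  then show ?case by (simp add: continuous_map_on_empty)
next
  case (Cons k ks)
  note \<psi> = Cons.prems(1) and \<psi>_bounds = Cons.prems(2) and e = Cons.prems(3) and e_in = Cons.prems(4)
  let ?avg = "\<lambda>ks w. geodesic_average X e (\<lambda>i. \<psi> i w) ks"
  define S where "S i = {w \<in> topspace T. \<psi> i w = 1}" for i
  define D where "D = {w \<in> topspace T. \<exists>i\<in>set ks. \<psi> i w = 1}"
  have closed_S: "closedin T (S i)" if "i \<in> set (k # ks)" for i
    unfolding S_def by (intro closedin_continuous_maps_eq[where Y=euclideanreal] \<psi> that) auto
  have "D = \<Union> (S ` set ks)"
    by (auto simp: S_def D_def)
  then have closed_D: "closedin T D"
    using closed_S by (auto intro!: closedin_Union)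
  have "continuous_map (subtopology T (S k)) (mtopology_of X) (\<lambda>_. e k)"
    using e by simp
  then have on_S: "continuous_map (subtopology T (S k)) (mtopology_of X) (?avg (k # ks))"
    by (rule continuous_map_eq) (use e in \<open>simp add: S_def\<close>)
  have on_D: "continuous_map (subtopology T D) (mtopology_of X) (?avg (k # ks))"
    unfolding geodesic_average.simps
  proof (rule continuous_map_divide_segment[OF X, where A=A])
    show "continuous_map (subtopology T D) (mtopology_of X) (?avg ks)"
      unfolding D_def using Cons by simp
    fix w assume "w \<in> topspace (subtopology T D)"
    then have w: "w \<in> topspace T" "\<exists>i\<in>set ks. \<psi> i w = 1"
      by (auto simp: D_def)
    then show "?avg ks w \<in> A w"
      using \<psi>_bounds e_in A by (intro geodesic_average_in_length_convex[OF X(2)]) auto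
    show "length_convex X (A w)" "\<psi> k w \<in> {0..1}" "\<psi> k w \<noteq> 0 \<Longrightarrow> e k \<in> A w"
      using w A \<psi>_bounds e_in by auto
  qed (use e \<psi> in \<open>auto intro: continuous_map_from_subtopology\<close>)
  have "{w \<in> topspace T. \<exists>i\<in>set (k # ks). \<psi> i w = 1} = S k \<union> D"
    by (auto simp: S_def D_def)
  then show ?case
    using continuous_map_subtopology_Un_closedin[OF _ closed_D on_S on_D] closed_S by simp
qed

section \<open>Selections of a relation\<close>

definition convex_selection ::
  "real \<Rightarrow> 'a metric \<Rightarrow> 'b metric \<Rightarrow> ('a \<times> 'b) set \<Rightarrow> ('a \<Rightarrow> 'b) \<Rightarrow> bool" where
  "convex_selection r X Y C f \<longleftrightarrow>
     continuous_map (mtopology_of X) (mtopology_of Y) f \<and>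
     (\<forall>x\<in>mspace X. \<forall>A. length_convex Y A \<and> C `` mball_of X x r \<subseteq> A \<longrightarrow> f x \<in> A)"

lemma convex_selectionD:
  assumes "convex_selection r X Y C f"
  shows "continuous_map (mtopology_of X) (mtopology_of Y) f"
    and "\<lbrakk>x \<in> mspace X; length_convex Y A; C `` mball_of X x r \<subseteq> A\<rbrakk> \<Longrightarrow> f x \<in> A"
  using assms by (simp_all add: convex_selection_def)

definition radial_cutoff :: "real \<Rightarrow> 'a metric \<Rightarrow> 'a \<Rightarrow> 'a \<Rightarrow> real" where
  "radial_cutoff r X p x = max 0 (min 1 (2 - 2 * mdist X p x / r))"

lemma
  shows radial_cutoff_nonneg [simp]: "0 \<le> radial_cutoff r X p x"
    and radial_cutoff_le_1 [simp]: "radial_cutoff r X p x \<le> 1"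
  by (simp_all add: radial_cutoff_def)

lemma radial_cutoff_eq_1:
  assumes "0 < r" "x \<in> mball_of X p (r / 2)"
  shows "radial_cutoff r X p x = 1"
  using assms by (simp add: radial_cutoff_def field_simps)

lemma radial_cutoff_eq_0:
  assumes "0 < r" "r \<le> mdist X p x"
  shows "radial_cutoff r X p x = 0"
proof -
  have "2 - 2 * mdist X p x / r \<le> 0"
    using assms by (simp add: field_simps)
  then show ?thesis
    by (simp add: radial_cutoff_def)
qed

lemma continuous_map_radial_cutoff:
  assumes "0 < r" "p \<in> mspace X"
  shows "continuous_map (mtopology_of X) euclideanreal (radial_cutoff r X p)"
  unfolding radial_cutoff_def using assms by (intro continuous_intros) auto

lemma convex_selection_geodesic_average:
  assumes Y: "compact_space (mtopology_of Y)" "complete_length_space Y"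
    and r: "0 < r" and "set ks \<subseteq> mspace X"
    and net: "mspace X \<subseteq> (\<Union>p\<in>set ks. mball_of X p (r / 2))"
    and e: "\<And>p. p \<in> set ks \<Longrightarrow> (p, e p) \<in> C"
    and convex: "\<And>x. x \<in> mspace X \<Longrightarrow> length_convex Y (A x)"
    and near: "\<And>x. x \<in> mspace X \<Longrightarrow> C `` mball_of X x r \<subseteq> A x"
  shows "convex_selection r X Y C (\<lambda>x. geodesic_average Y e (\<lambda>p. radial_cutoff r X p x) ks)"
proof -
  let ?\<psi> = "radial_cutoff r X"
  let ?f = "\<lambda>x. geodesic_average Y e (\<lambda>p. ?\<psi> p x) ks"
  have ks: "p \<in> mspace X" if "p \<in> set ks" for p
    using that assms(4) by blast
  have covered: "\<exists>p\<in>set ks. ?\<psi> p x = 1" if "x \<in> mspace X" for x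
    using subsetD[OF net that] radial_cutoff_eq_1[OF r] by (metis UN_E)
  have e_image: "e p \<in> C `` mball_of X x r"
    if "p \<in> set ks" "x \<in> mspace X" "?\<psi> p x \<noteq> 0" for p x
  proof (rule ImageI[OF e[OF that(1)]])
    have "mdist X p x < r"
      using radial_cutoff_eq_0[OF r, of X p x] that(3) by linarith
    then show "p \<in> mball_of X x r"
      using ks that by (simp add: mdist_commute)
  qed
  have "continuous_map (subtopology (mtopology_of X)
      {x \<in> topspace (mtopology_of X). \<exists>p\<in>set ks. ?\<psi> p x = 1}) (mtopology_of Y) ?f"
  proof (rule continuous_map_geodesic_average[OF Y, where A=A])
    fix p assume p: "p \<in> set ks"
    show "continuous_map (mtopology_of X) euclideanreal (?\<psi> p)"
      using r ks[OF p] by (rule continuous_map_radial_cutoff)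
    show "e p \<in> A x" if "x \<in> topspace (mtopology_of X)" "?\<psi> p x \<noteq> 0" for x
      using e_image[OF p _ that(2)] near that(1) by auto
    have "e p \<in> C `` mball_of X p r"
      using ks[OF p] r by (intro ImageI[OF e[OF p]]) simp
    then have "e p \<in> A p"
      using near[OF ks[OF p]] by blast
    then show "e p \<in> mspace Y"
      using convex[OF ks[OF p]] by (auto simp: length_convex_def)
  qed (use convex in auto)
  moreover have "{x \<in> topspace (mtopology_of X). \<exists>p\<in>set ks. ?\<psi> p x = 1} =
      topspace (mtopology_of X)"
    using covered by auto
  ultimately have "continuous_map (mtopology_of X) (mtopology_of Y) ?f"
    by (simp only: subtopology_topspace)
  moreover have "?f x \<in> B"
    if x: "x \<in> mspace X" and B: "length_convex Y B" "C `` mball_of X x r \<subseteq> B" for x B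
  proof (rule geodesic_average_in_length_convex[OF Y(2) B(1)])
    show "e p \<in> B" if "p \<in> set ks" "?\<psi> p x \<noteq> 0" for p
      using e_image[OF that(1) x that(2)] B(2) by auto
  qed (use covered[OF x] in auto)
  ultimately show ?thesis
    by (simp add: convex_selection_def)
qed

lemma convex_selection_exists:
  assumes X: "compact_space (mtopology_of X)"
    and Y: "compact_space (mtopology_of Y)" "complete_length_space Y"
    and r: "0 < r" and C: "mspace X \<subseteq> Domain C"
    and convex: "\<And>x. x \<in> mspace X \<Longrightarrow> \<exists>A. length_convex Y A \<and> C `` mball_of X x r \<subseteq> A"
  obtains f where "convex_selection r X Y C f"
proof -
  obtain A where A: "\<And>x. x \<in> mspace X \<Longrightarrow> length_convex Y (A x)"
    "\<And>x. x \<in> mspace X \<Longrightarrow> C `` mball_of X x r \<subseteq> A x"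
    using convex by metis
  have "\<forall>p\<in>mspace X. \<exists>q. (p, q) \<in> C"
    using C by blast
  then obtain e where e: "\<And>p. p \<in> mspace X \<Longrightarrow> (p, e p) \<in> C"
    by metis
  obtain K where K: "finite K" "K \<subseteq> mspace X" "mspace X \<subseteq> (\<Union>p\<in>K. mball_of X p (r / 2))"
    using compact_space_finite_net[OF X] r by (metis half_gt_zero)
  obtain ks where ks: "set ks = K"
    using finite_list[OF K(1)] by blast
  show thesis
  proof (rule that, rule convex_selection_geodesic_average[OF Y r])
    show "(p, e p) \<in> C" if "p \<in> set ks" for p
      using that e K(2) ks by auto
  qed (use A K(2,3) ks in auto)
qed

section \<open>Close correspondences\<close>

definition close_correspondence ::
  "real \<Rightarrow> real \<Rightarrow> 'a metric \<Rightarrow> 'b metric \<Rightarrow> ('a \<times> 'b) set \<Rightarrow> bool" where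
  "close_correspondence \<epsilon> R X Y C \<longleftrightarrow> correspondence X Y C \<and>
     (\<forall>(x\<^sub>1, y\<^sub>1)\<in>C. \<forall>(x\<^sub>2, y\<^sub>2)\<in>C. min (mdist X x\<^sub>1 x\<^sub>2) (mdist Y y\<^sub>1 y\<^sub>2) \<le> R \<longrightarrow>
        \<bar>mdist X x\<^sub>1 x\<^sub>2 - mdist Y y\<^sub>1 y\<^sub>2\<bar> \<le> 2 * \<epsilon>)"

lemma GH_close_iff: "GH_close \<epsilon> R X Y \<longleftrightarrow> (\<exists>C. close_correspondence \<epsilon> R X Y C)"
  by (simp add: GH_close_def close_correspondence_def)

lemma close_correspondence_subset:
  "close_correspondence \<epsilon> R X Y C \<Longrightarrow> C \<subseteq> mspace X \<times> mspace Y"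
  by (simp add: close_correspondence_def correspondence_def)

lemma close_correspondence_Domain:
  "close_correspondence \<epsilon> R X Y C \<Longrightarrow> Domain C = mspace X"
  by (simp add: close_correspondence_def correspondence_def Domain_fst)

lemma close_correspondence_distortion:
  assumes "close_correspondence \<epsilon> R X Y C" "(x\<^sub>1, y\<^sub>1) \<in> C" "(x\<^sub>2, y\<^sub>2) \<in> C"
    and "min (mdist X x\<^sub>1 x\<^sub>2) (mdist Y y\<^sub>1 y\<^sub>2) \<le> R"
  shows "\<bar>mdist X x\<^sub>1 x\<^sub>2 - mdist Y y\<^sub>1 y\<^sub>2\<bar> \<le> 2 * \<epsilon>"
  using assms unfolding close_correspondence_def by fastforce

lemma close_correspondence_converse:
  assumes C: "close_correspondence \<epsilon> R X Y C"
  shows "close_correspondence \<epsilon> R Y X (C\<inverse>)"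
proof -
  have "fst ` (C\<inverse>) = snd ` C" "snd ` (C\<inverse>) = fst ` C"
    by force+
  then have "correspondence Y X (C\<inverse>)"
    using C by (auto simp: close_correspondence_def correspondence_def)
  moreover have "\<bar>mdist Y y\<^sub>1 y\<^sub>2 - mdist X x\<^sub>1 x\<^sub>2\<bar> \<le> 2 * \<epsilon>"
    if "(x\<^sub>1, y\<^sub>1) \<in> C" "(x\<^sub>2, y\<^sub>2) \<in> C" "min (mdist Y y\<^sub>1 y\<^sub>2) (mdist X x\<^sub>1 x\<^sub>2) \<le> R"
    for x\<^sub>1 y\<^sub>1 x\<^sub>2 y\<^sub>2
    using close_correspondence_distortion[OF C that(1,2)] that(3)
    by (simp add: min.commute abs_minus_commute)
  ultimately show ?thesis
    by (auto simp: close_correspondence_def)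
qed

lemma close_correspondence_dist_le:
  assumes "close_correspondence \<epsilon> R X Y C" "(x\<^sub>1, y\<^sub>1) \<in> C" "(x\<^sub>2, y\<^sub>2) \<in> C" "mdist X x\<^sub>1 x\<^sub>2 \<le> R"
  shows "mdist Y y\<^sub>1 y\<^sub>2 \<le> mdist X x\<^sub>1 x\<^sub>2 + 2 * \<epsilon>"
  using close_correspondence_distortion[OF assms(1-3)] assms(4) by linarith

lemma close_correspondence_image_mball:
  assumes C: "close_correspondence \<epsilon> R X Y C" and xq: "(x, q) \<in> C" and "r \<le> R"
  shows "C `` mball_of X x r \<subseteq> mball_of Y q (r + 2 * \<epsilon>)"
proof
  fix q' assume "q' \<in> C `` mball_of X x r"
  then obtain p where p: "(p, q') \<in> C" "mdist X x p < r"
    by auto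
  then have "mdist Y q q' < r + 2 * \<epsilon>"
    using close_correspondence_dist_le[OF C xq p(1)] \<open>r \<le> R\<close> by linarith
  then show "q' \<in> mball_of Y q (r + 2 * \<epsilon>)"
    using close_correspondence_subset[OF C] xq p(1) by auto
qed

lemma close_correspondence_round_trip:
  assumes C: "close_correspondence \<epsilon> R X Y C" and xq: "(x, q) \<in> C"
    and y: "y \<in> mball_of Y q s" and "r + s \<le> R"
  shows "C\<inverse> `` mball_of Y y r \<subseteq> mball_of X x (r + s + 2 * \<epsilon>)"
proof -
  have "mball_of Y y r \<subseteq> mball_of Y q (r + s)"
  proof
    fix q' assume "q' \<in> mball_of Y y r"
    then show "q' \<in> mball_of Y q (r + s)"
      using y mdist_triangle[of q Y y q'] by auto
  qed
  then have "C\<inverse> `` mball_of Y y r \<subseteq> C\<inverse> `` mball_of Y q (r + s)"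
    by (rule Image_mono[OF order_refl])
  also have "\<dots> \<subseteq> mball_of X x (r + s + 2 * \<epsilon>)"
    using xq \<open>r + s \<le> R\<close>
    by (intro close_correspondence_image_mball[OF close_correspondence_converse[OF C]]) auto
  finally show ?thesis .
qed

lemma close_correspondence_convex_selection:
  assumes X: "compact_space (mtopology_of X)"
    and Y: "compact_space (mtopology_of Y)" "complete_length_space Y"
    and C: "close_correspondence \<epsilon> R X Y C" and r: "0 < r" "r \<le> R" "0 < r + 2 * \<epsilon>"
    and \<rho>: "ennreal (r + 2 * \<epsilon>) < convexity_radius Y"
  obtains f where "convex_selection r X Y C f"
    and "\<And>x q. (x, q) \<in> C \<Longrightarrow> f x \<in> mball_of Y q (r + 2 * \<epsilon>)"
proof -
  have convex: "length_convex Y (mball_of Y q (r + 2 * \<epsilon>))" if "(x, q) \<in> C" for x q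
    using that close_correspondence_subset[OF C] r \<rho> by (intro length_convex_mball) auto
  note image = close_correspondence_image_mball[OF C _ r(2)]
  obtain f where f: "convex_selection r X Y C f"
  proof (rule convex_selection_exists[OF X Y r(1)])
    show "mspace X \<subseteq> Domain C"
      by (simp add: close_correspondence_Domain[OF C])
    fix x assume "x \<in> mspace X"
    then obtain q where xq: "(x, q) \<in> C"
      using close_correspondence_Domain[OF C] by auto
    show "\<exists>A. length_convex Y A \<and> C `` mball_of X x r \<subseteq> A"
      using convex[OF xq] image[OF xq] by blast
  qed
  moreover have "f x \<in> mball_of Y q (r + 2 * \<epsilon>)" if "(x, q) \<in> C" for x q
    using close_correspondence_subset[OF C] that
    by (intro convex_selectionD(2)[OF f _ convex[OF that] image[OF that]]) auto
  ultimately show thesis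
    using that by blast
qed

lemma convex_selection_compose_homotopic_id:
  assumes X: "compact_space (mtopology_of X)" "complete_length_space X"
    and C: "close_correspondence \<epsilon> R X Y C"
    and f: "continuous_map (mtopology_of X) (mtopology_of Y) f"
      "\<And>x q. (x, q) \<in> C \<Longrightarrow> f x \<in> mball_of Y q s"
    and g: "convex_selection r Y X (C\<inverse>) g"
    and R: "r + s \<le> R"
    and \<rho>: "0 < r + s + 2 * \<epsilon>" "ennreal (r + s + 2 * \<epsilon>) < convexity_radius X"
  shows "homotopic_with (\<lambda>_. True) (mtopology_of X) (mtopology_of X) (g \<circ> f) id"
proof (rule homotopic_with_if_common_length_convex[OF X])
  show "continuous_map (mtopology_of X) (mtopology_of X) (g \<circ> f)"
    using f(1) convex_selectionD(1)[OF g] by (rule continuous_map_compose)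
  fix x assume "x \<in> topspace (mtopology_of X)"
  then have x: "x \<in> mspace X"
    by simp
  then show convex: "length_convex X (mball_of X x (r + s + 2 * \<epsilon>))"
    using \<rho> by (rule length_convex_mball)
  show "id x \<in> mball_of X x (r + s + 2 * \<epsilon>)"
    using x \<rho>(1) by simp
  obtain q where xq: "(x, q) \<in> C"
    using x close_correspondence_Domain[OF C] by auto
  have "f x \<in> mspace Y"
    using f(2)[OF xq] by simp
  then show "(g \<circ> f) x \<in> mball_of X x (r + s + 2 * \<epsilon>)"
    using convex_selectionD(2)[OF g _ convex]
      close_correspondence_round_trip[OF C xq f(2)[OF xq] R]
    by simp
qed simp

text \<open>The radius \<open>r\<close> is chosen so that the round trip stays in balls of radius
  \<open>r + (r + 2 \<epsilon>) + 2 \<epsilon> = \<beta>\<close>.\<close>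

lemma close_correspondence_homotopy_equivalent:
  assumes X: "compact_space (mtopology_of X)" "complete_length_space X"
      "ennreal \<beta> < convexity_radius X"
    and Y: "compact_space (mtopology_of Y)" "complete_length_space Y"
      "ennreal \<beta> < convexity_radius Y"
    and C: "close_correspondence \<epsilon> \<beta> X Y C" and \<epsilon>: "0 \<le> \<epsilon>" "4 * \<epsilon> < \<beta>"
  shows "mtopology_of X homotopy_equivalent_space mtopology_of Y"
proof -
  define r where "r = \<beta> / 2 - 2 * \<epsilon>"
  have r: "0 < r" "r \<le> \<beta>" "0 < r + 2 * \<epsilon>" "r + (r + 2 * \<epsilon>) \<le> \<beta>" "r + (r + 2 * \<epsilon>) + 2 * \<epsilon> = \<beta>"
    using \<epsilon> by (simp_all add: r_def)
  have "ennreal (r + 2 * \<epsilon>) \<le> ennreal \<beta>"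
    using \<epsilon> by (intro ennreal_leI) (simp add: r_def)
  then have \<rho>: "ennreal (r + 2 * \<epsilon>) < convexity_radius X" "ennreal (r + 2 * \<epsilon>) < convexity_radius Y"
    using X(3) Y(3) by (auto intro: le_less_trans)
  note C_converse = close_correspondence_converse[OF C]
  obtain f where f: "convex_selection r X Y C f"
      "\<And>x q. (x, q) \<in> C \<Longrightarrow> f x \<in> mball_of Y q (r + 2 * \<epsilon>)"
    using close_correspondence_convex_selection[OF X(1) Y(1,2) C r(1-3) \<rho>(2)] by blast
  obtain g where g: "convex_selection r Y X (C\<inverse>) g"
      "\<And>y p. (y, p) \<in> C\<inverse> \<Longrightarrow> g y \<in> mball_of X p (r + 2 * \<epsilon>)"
    using close_correspondence_convex_selection[OF Y(1) X(1,2) C_converse r(1-3) \<rho>(1)] by blast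
  have "homotopic_with (\<lambda>_. True) (mtopology_of X) (mtopology_of X) (g \<circ> f) id"
    using X(3) \<epsilon> r(4,5) f g(1)
    by (intro convex_selection_compose_homotopic_id[OF X(1,2) C convex_selectionD(1)[OF f(1)] f(2)])
       auto
  moreover have "homotopic_with (\<lambda>_. True) (mtopology_of Y) (mtopology_of Y) (f \<circ> g) id"
    using Y(3) \<epsilon> r(4,5) g f(1)
    by (intro convex_selection_compose_homotopic_id[OF Y(1,2) C_converse
          convex_selectionD(1)[OF g(1)] g(2)]) auto
  ultimately show ?thesis
    using convex_selectionD(1)[OF f(1)] convex_selectionD(1)[OF g(1)]
    unfolding homotopy_equivalent_space_def by blast
qed

lemma GH_dist_less_imp_GH_close:
  assumes "GH_dist X Y < ennreal \<epsilon>"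
  shows "GH_close \<epsilon> R X Y"
proof -
  have "0 < \<epsilon>"
    using assms by (cases "0 < \<epsilon>") (auto simp: ennreal_neg)
  have "(INF C\<in>{C. correspondence X Y C}.
      SUP ((x\<^sub>1, y\<^sub>1), (x\<^sub>2, y\<^sub>2))\<in>C \<times> C. ennreal \<bar>mdist X x\<^sub>1 x\<^sub>2 - mdist Y y\<^sub>1 y\<^sub>2\<bar>) < ennreal \<epsilon> * 2"
    using assms unfolding GH_dist_def by (simp add: divide_less_ennreal)
  also have "ennreal \<epsilon> * 2 = ennreal (2 * \<epsilon>)"
    using \<open>0 < \<epsilon>\<close> by (simp add: ennreal_mult mult.commute)
  finally obtain C where C: "correspondence X Y C" and
    sup: "(SUP ((x\<^sub>1, y\<^sub>1), (x\<^sub>2, y\<^sub>2))\<in>C \<times> C. ennreal \<bar>mdist X x\<^sub>1 x\<^sub>2 - mdist Y y\<^sub>1 y\<^sub>2\<bar>) < ennreal (2 * \<epsilon>)"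
    unfolding INF_less_iff by blast
  have "\<bar>mdist X x\<^sub>1 x\<^sub>2 - mdist Y y\<^sub>1 y\<^sub>2\<bar> \<le> 2 * \<epsilon>" if "(x\<^sub>1, y\<^sub>1) \<in> C" "(x\<^sub>2, y\<^sub>2) \<in> C" for x\<^sub>1 x\<^sub>2 y\<^sub>1 y\<^sub>2
  proof -
    have "ennreal \<bar>mdist X x\<^sub>1 x\<^sub>2 - mdist Y y\<^sub>1 y\<^sub>2\<bar> \<le> ennreal (2 * \<epsilon>)"
      using that
      by (intro order_trans[OF SUP_upper2 less_imp_le[OF sup], of "((x\<^sub>1, y\<^sub>1), (x\<^sub>2, y\<^sub>2))"]) auto
    then show ?thesis
      using \<open>0 < \<epsilon>\<close> by simp
  qed
  then show ?thesis
    using C unfolding GH_close_def by (intro exI[of _ C]) auto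
qed

lemma Delta_le_convexity_radius: "Delta \<kappa> X \<le> convexity_radius X"
  by (simp add: Delta_def)

theorem theorem3:
  fixes \<kappa> \<xi> \<beta> :: real and X :: "'a metric" and X' :: "'b metric"
  assumes "compact_space (mtopology_of X)" and "curvature_le X \<kappa>"
    and "compact_space (mtopology_of X')" and "curvature_le X' \<kappa>"
    and "\<xi> \<in> {0<..1/14}"
    and "0 < \<beta>"
    and "ennreal \<beta> < ennreal (1 / (1 + 2 * \<xi>)) * min (Delta \<kappa> X) (Delta \<kappa> X')"
  shows "(GH_close (\<xi> * \<beta>) \<beta> X X' \<longrightarrow>
            mtopology_of X homotopy_equivalent_space mtopology_of X') \<and>
         (GH_dist X X' < ennreal (\<xi> * \<beta>) \<longrightarrow>
            mtopology_of X homotopy_equivalent_space mtopology_of X')"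
proof -
  have "ennreal (1 / (1 + 2 * \<xi>)) \<le> 1"
    using assms(5) by simp
  then have "ennreal (1 / (1 + 2 * \<xi>)) * min (Delta \<kappa> X) (Delta \<kappa> X') \<le>
      1 * min (Delta \<kappa> X) (Delta \<kappa> X')"
    by (intro mult_right_mono) auto
  then have "ennreal \<beta> < Delta \<kappa> X" "ennreal \<beta> < Delta \<kappa> X'"
    using assms(7) by auto
  then have "ennreal \<beta> < convexity_radius X" "ennreal \<beta> < convexity_radius X'"
    using Delta_le_convexity_radius less_le_trans by blast+
  moreover have "complete_length_space X" "complete_length_space X'"
    using assms(2,4) by (simp_all add: curvature_le_def)
  moreover have "0 \<le> \<xi> * \<beta>" "4 * (\<xi> * \<beta>) < \<beta>"
    using assms(5,6) by auto
  ultimately have "mtopology_of X homotopy_equivalent_space mtopology_of X'"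
    if "GH_close (\<xi> * \<beta>) \<beta> X X'"
    using that close_correspondence_homotopy_equivalent assms(1,3) unfolding GH_close_iff by blast
  then show ?thesis
    using GH_dist_less_imp_GH_close by blast
qed

end
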